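(* Let $X,Y$ be separable Hilbert spaces, let $(X_N)_{N\in\mathbb{N}_0}$ be a nested family of subspaces of $X$ with orthogonal projectors $P_N:X\to X_N$, and let $T_N:X_N\to Y$ be linear operators with (i) $\|T_N\|\le 1$, (ii) $T_Nx_M=T_Mx_M$ for all $N\ge M$ and $x_M\in X_M$, (iii) $\mathcal{R}(T_N^* )\subseteq X_N$. Let $y\in Y$ and assume that there exist $N_*\in\mathbb{N}_0$ and $x_*\in X_{N_*}$ with $T_{N_*}x_*=y$. Then, for exact data ($\delta=0$, $y^\delta=y$), the multi-level Landweber–Richardson algorithm converges to a solution $\hat x$; that is, either the algorithm terminates after finitely many iterations and its output $\hat x$ is a solution, or it does not terminate and the iterates it generates converge in norm to a solution $\hat x$.
   Context: Nested means $X_N\subseteq X_{N+1}$ for all $N$. A solution is an element $x\in X_N$, for some $N\in\mathbb{N}_0$, with $T_Nx=y$ (by (ii), a solution on a lower level is a solution on every higher level). Landweber–Richardson iteration at level $N$: $x_{k+1,N}^\delta=x_{k,N}^\delta-T_N^*(T_Nx_{k,N}^\delta-y^\delta)$, $k=0,1,2,\dots$. Multi-level Landweber–Richardson algorithm (parameters $\eta>0$, $\tau>1$, noise level $\delta\ge 0$, data $y^\delta$ with $\|y^\delta-y\|\le\delta$). Level $0$: given $x_{0,0}^\delta\in X_0$, consider the conditions (a) $\|T_0x_{0,0}^\delta-y^\delta\|>2(1+\eta)(\delta+\|P_0x_*-x_*\|)$ and (b) $\|T_0x_{0,0}^\delta-y^\delta\|>2(1+\eta)\tau\delta$. If (b)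 fails, $x_{0,0}^\delta$ is accepted as approximate solution and the algorithm terminates. If (b) holds and (a) fails, one chooses a level $J$ with $\|T_Jx_{0,0}^\delta-y^\delta\|>2(1+\eta)(\delta+\|P_Jx_*-x_*\|)$ and renumbers the levels so that $J$ becomes level $0$. Then the Landweber–Richardson iteration is run at level $0$ from $x_{0,0}^\delta$ until, for the first time, $\|T_0x_{k+1,0}^\delta-y^\delta\|\le 2(1+\eta)(\delta+\|P_0x_*-x_*\|)$; this $k$ is denoted $l_*(0,\delta)$. From level $N$ to level $N+1$: if $\|T_{N+1}x_{l_*(N,\delta)+1,N}^\delta-y^\delta\|\le 2(1+\eta)\tau\delta$, the algorithm terminates with output $x_{l_*(N,\delta)+1,N}^\delta$. Otherwise set $x_{0,N+1}^\delta:=x_{l_*(N,\delta),N}^\delta$ and run the Landweber–Richardson iteration at level $N+1$ from $x_{0,N+1}^\delta$ until, for the first time, $\|T_{N+1}x_{k+1,N+1}^\delta-y^\delta\|\le 2(1+\eta)(\delta+\|P_{N+1}x_*-x_*\|)$; this $k$ is denoted $l_*(N+1,\delta)$. *)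

theory Defs
  imports "HOL-Analysis.Analysis"
begin

section \<open>Operators on a subspace\<close>

text \<open>An operator \<open>X\<^sub>N \<rightarrow> Y\<close> is a function on the ambient space of which only the values on
  the subspace \<open>S = X\<^sub>N\<close> matter.\<close>

definition linear_on :: "'a::real_vector set \<Rightarrow> ('a \<Rightarrow> 'b::real_vector) \<Rightarrow> bool" where
  "linear_on S f \<longleftrightarrow>
     (\<forall>x\<in>S. \<forall>y\<in>S. f (x + y) = f x + f y) \<and> (\<forall>c. \<forall>x\<in>S. f (c *\<^sub>R x) = c *\<^sub>R f x)"

text \<open>The relative version of \<^const>\<open>onorm\<close>; it is extended-real-valued, so that the norm of an
  unbounded operator is \<open>\<infinity>\<close>.\<close>

definition onorm_on :: "'a::real_normed_vector set \<Rightarrow> ('a \<Rightarrow> 'b::real_normed_vector) \<Rightarrow> ereal" where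
  "onorm_on S f = (SUP x\<in>S. ereal (norm (f x) / norm x))"

text \<open>The Hilbert space adjoint \<open>Y \<rightarrow> S\<close> of an operator \<open>S \<rightarrow> Y\<close>. By the Riesz theorem the
  description is proper whenever \<open>S\<close> is a closed subspace and \<open>f\<close> is linear and bounded on \<open>S\<close>.\<close>

definition adjoint_on :: "'a::real_inner set \<Rightarrow> ('a \<Rightarrow> 'b::real_inner) \<Rightarrow> 'b \<Rightarrow> 'a" where
  "adjoint_on S f z = (THE w. w \<in> S \<and> (\<forall>x\<in>S. inner (f x) z = inner x w))"

text \<open>A subspace of a Hilbert space that has an orthogonal projector is automatically closed.\<close>

definition orthogonal_projector :: "'a::real_inner set \<Rightarrow> ('a \<Rightarrow> 'a) \<Rightarrow> bool" where
  "orthogonal_projector S p \<longleftrightarrow> (\<forall>x. p x \<in> S \<and> (\<forall>s\<in>S. orthogonal (x - p x) s))"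

definition is_solution :: "(nat \<Rightarrow> 'a set) \<Rightarrow> (nat \<Rightarrow> 'a \<Rightarrow> 'b) \<Rightarrow> 'b \<Rightarrow> 'a \<Rightarrow> bool" where
  "is_solution X T y x \<longleftrightarrow> (\<exists>N. x \<in> X N \<and> T N x = y)"


section \<open>The multi-level Landweber--Richardson algorithm\<close>

text \<open>\<open>landweber X T yd N z k\<close> is the iterate \<open>x\<^sub>k\<^sub>,\<^sub>N\<close> for the data \<open>yd\<close> when the iteration on
  level \<open>N\<close> is started from \<open>x\<^sub>0\<^sub>,\<^sub>N = z\<close>.\<close>

primrec landweber ::
  "(nat \<Rightarrow> 'a::real_inner set) \<Rightarrow> (nat \<Rightarrow> 'a \<Rightarrow> 'b::real_inner) \<Rightarrow> 'b \<Rightarrow> nat \<Rightarrow> 'a \<Rightarrow> nat \<Rightarrow> 'a" where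
  "landweber X T yd N z 0 = z"
| "landweber X T yd N z (Suc k) =
     landweber X T yd N z k
       - adjoint_on (X N) (T N) (T N (landweber X T yd N z k) - yd)"

definition level_tol ::
  "(nat \<Rightarrow> 'a::real_normed_vector \<Rightarrow> 'a) \<Rightarrow> 'a \<Rightarrow> real \<Rightarrow> real \<Rightarrow> nat \<Rightarrow> real" where
  "level_tol P xs \<eta> \<delta> N = 2 * (1 + \<eta>) * (\<delta> + norm (P N xs - xs))"

definition final_tol :: "real \<Rightarrow> real \<Rightarrow> real \<Rightarrow> real" where
  "final_tol \<eta> \<tau> \<delta> = 2 * (1 + \<eta>) * \<tau> * \<delta>"

text \<open>\<open>Iterating N z k\<close>: the algorithm is on level \<open>N\<close>, where it started from \<open>x\<^sub>0\<^sub>,\<^sub>N = z\<close>, and has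
  computed \<open>x\<^sub>k\<^sub>,\<^sub>N\<close>. \<open>Terminated x\<close>: it has stopped with output \<open>x\<close>.\<close>

datatype 'a mlr_state = Iterating nat 'a nat | Terminated 'a

text \<open>Instead of renumbering the levels when a starting level \<open>J\<close> is chosen, the original numbers
  are kept and the algorithm starts on level \<open>J\<close>. The choice of \<open>J\<close> is not determined, so this is a
  predicate on the possible initial states.\<close>

inductive mlr_initial ::
  "(nat \<Rightarrow> 'a::real_inner \<Rightarrow> 'b::real_inner) \<Rightarrow> (nat \<Rightarrow> 'a \<Rightarrow> 'a) \<Rightarrow> 'a \<Rightarrow> real \<Rightarrow> real \<Rightarrow>
    real \<Rightarrow> 'b \<Rightarrow> 'a \<Rightarrow> 'a mlr_state \<Rightarrow> bool"
  for T P xs \<eta> \<tau> \<delta> yd x0 where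
  accept: "mlr_initial T P xs \<eta> \<tau> \<delta> yd x0 (Terminated x0)"
    if "\<not> norm (T 0 x0 - yd) > final_tol \<eta> \<tau> \<delta>"
| level0: "mlr_initial T P xs \<eta> \<tau> \<delta> yd x0 (Iterating 0 x0 0)"
    if "norm (T 0 x0 - yd) > final_tol \<eta> \<tau> \<delta>"
      and "norm (T 0 x0 - yd) > level_tol P xs \<eta> \<delta> 0"
| levelJ: "mlr_initial T P xs \<eta> \<tau> \<delta> yd x0 (Iterating J x0 0)"
    if "norm (T 0 x0 - yd) > final_tol \<eta> \<tau> \<delta>"
      and "\<not> norm (T 0 x0 - yd) > level_tol P xs \<eta> \<delta> 0"
      and "norm (T J x0 - yd) > level_tol P xs \<eta> \<delta> J"

text \<open>The inner test is reached for the first \<open>k\<close> for which the residual of \<open>x\<^sub>k\<^sub>+\<^sub>1\<^sub>,\<^sub>N\<close> is at most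
  the tolerance of level \<open>N\<close>, that is, for \<open>k = l\<^sub>*(N, \<delta>)\<close>. The next level then starts from
  \<open>x\<^sub>k\<^sub>,\<^sub>N\<close>, whereas the candidate for the output is \<open>x\<^sub>k\<^sub>+\<^sub>1\<^sub>,\<^sub>N\<close>.\<close>

fun mlr_step ::
  "(nat \<Rightarrow> 'a::real_inner set) \<Rightarrow> (nat \<Rightarrow> 'a \<Rightarrow> 'b::real_inner) \<Rightarrow> (nat \<Rightarrow> 'a \<Rightarrow> 'a) \<Rightarrow> 'a \<Rightarrow>
    real \<Rightarrow> real \<Rightarrow> real \<Rightarrow> 'b \<Rightarrow> 'a mlr_state \<Rightarrow> 'a mlr_state" where
  "mlr_step X T P xs \<eta> \<tau> \<delta> yd (Iterating N z 0) = Iterating N z 1"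
| "mlr_step X T P xs \<eta> \<tau> \<delta> yd (Iterating N z (Suc k)) =
     (if \<not> norm (T N (landweber X T yd N z (Suc k)) - yd) \<le> level_tol P xs \<eta> \<delta> N
      then Iterating N z (Suc (Suc k))
      else if norm (T (Suc N) (landweber X T yd N z (Suc k)) - yd) \<le> final_tol \<eta> \<tau> \<delta>
      then Terminated (landweber X T yd N z (Suc k))
      else Iterating (Suc N) (landweber X T yd N z k) 0)"
| "mlr_step X T P xs \<eta> \<tau> \<delta> yd (Terminated x) = Terminated x"

definition mlr_run ::
  "(nat \<Rightarrow> 'a::real_inner set) \<Rightarrow> (nat \<Rightarrow> 'a \<Rightarrow> 'b::real_inner) \<Rightarrow> (nat \<Rightarrow> 'a \<Rightarrow> 'a) \<Rightarrow> 'a \<Rightarrow>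
    real \<Rightarrow> real \<Rightarrow> real \<Rightarrow> 'b \<Rightarrow> 'a mlr_state \<Rightarrow> nat \<Rightarrow> 'a mlr_state" where
  "mlr_run X T P xs \<eta> \<tau> \<delta> yd s n = (mlr_step X T P xs \<eta> \<tau> \<delta> yd ^^ n) s"

fun mlr_iterate ::
  "(nat \<Rightarrow> 'a::real_inner set) \<Rightarrow> (nat \<Rightarrow> 'a \<Rightarrow> 'b::real_inner) \<Rightarrow> 'b \<Rightarrow> 'a mlr_state \<Rightarrow> 'a" where
  "mlr_iterate X T yd (Iterating N z k) = landweber X T yd N z k"
| "mlr_iterate X T yd (Terminated x) = x"

text \<open>The algorithm, run from the initial state \<open>s\<close>, converges to \<open>x\<close>: it either terminates with
  output \<open>x\<close>, or it does not terminate and all the iterates it computes, in the order of their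
  computation, form a sequence with limit \<open>x\<close>.\<close>

definition mlr_converges ::
  "(nat \<Rightarrow> 'a::real_inner set) \<Rightarrow> (nat \<Rightarrow> 'a \<Rightarrow> 'b::real_inner) \<Rightarrow> (nat \<Rightarrow> 'a \<Rightarrow> 'a) \<Rightarrow> 'a \<Rightarrow>
    real \<Rightarrow> real \<Rightarrow> real \<Rightarrow> 'b \<Rightarrow> 'a mlr_state \<Rightarrow> 'a \<Rightarrow> bool" where
  "mlr_converges X T P xs \<eta> \<tau> \<delta> yd s x \<longleftrightarrow>
     (\<exists>n. mlr_run X T P xs \<eta> \<tau> \<delta> yd s n = Terminated x) \<or>
     ((\<nexists>n z. mlr_run X T P xs \<eta> \<tau> \<delta> yd s n = Terminated z) \<and>
      (\<lambda>n. mlr_iterate X T yd (mlr_run X T P xs \<eta> \<tau> \<delta> yd s n)) \<longlonglongrightarrow> x)"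

end

theory Submission
  imports Defs
begin

text \<open>
  From level \<open>Ns\<close> on the tolerance vanishes, because \<open>xs\<close> lies in the subspace. On a level with
  positive tolerance, the residual of \<open>P N xs\<close> is smaller than that of the iterates by the factor
  \<open>2 (1 + \<eta>)\<close>, so each Landweber step decreases the squared distance to \<open>P N xs\<close> by a fixed amount
  and the level is left after finitely many steps. On a level with tolerance \<open>0\<close> the equation is
  solvable; if the residual vanishes after finitely many steps then the algorithm stops with a
  solution, and otherwise it stays on this level for ever. In that case the squared residuals are
  summable and the residuals are nonincreasing, and together these make the iterates Cauchy.
\<close>

section \<open>Nonexpansive operators on a subspace\<close>

text \<open>A single level in isolation: it is interpreted with \<open>X N\<close>,
  \<open>T N\<close> and \<open>P N\<close>, for an arbitrary \<open>N\<close>.\<close>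

locale nonexpansive_on =
  fixes S :: "'a::{real_inner, complete_space} set"
    and f :: "'a \<Rightarrow> 'b::real_inner"
    and p :: "'a \<Rightarrow> 'a"
  assumes sub: "subspace S"
    and proj: "orthogonal_projector S p"
    and lin: "linear_on S f"
    and onorm_le: "onorm_on S f \<le> 1"
begin

lemma add: "x \<in> S \<Longrightarrow> z \<in> S \<Longrightarrow> f (x + z) = f x + f z"
  and scale: "x \<in> S \<Longrightarrow> f (c *\<^sub>R x) = c *\<^sub>R f x"
  using lin by (auto simp: linear_on_def)

lemma zero: "f 0 = 0"
  using scale[of 0 0] subspace_0[OF sub] by simp

lemma diff: "x \<in> S \<Longrightarrow> z \<in> S \<Longrightarrow> f (x - z) = f x - f z"
  using add[of x "- z"] scale[of z "- 1"] subspace_neg[OF sub, of z] by simp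

lemma norm_le:
  assumes "x \<in> S"
  shows "norm (f x) \<le> norm x"
proof (cases "x = 0")
  case False
  have "ereal (norm (f x) / norm x) \<le> onorm_on S f"
    unfolding onorm_on_def using assms by (rule SUP_upper)
  then have "ereal (norm (f x) / norm x) \<le> 1"
    using onorm_le by (rule order_trans)
  then show ?thesis
    using False by (simp add: divide_le_eq)
qed (simp add: zero)

lemma tendsto:
  assumes "\<And>n. u n \<in> S" "l \<in> S" "u \<longlonglongrightarrow> l"
  shows "(\<lambda>n. f (u n)) \<longlonglongrightarrow> f l"
proof (rule LIM_zero_cancel, rule Lim_null_comparison)
  show "\<forall>\<^sub>F n in sequentially. norm (f (u n) - f l) \<le> norm (u n - l)"
    using norm_le[OF subspace_diff[OF sub assms(1,2)]] diff[OF assms(1,2)] by simp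
  show "(\<lambda>n. norm (u n - l)) \<longlonglongrightarrow> 0"
    using assms(3) by (simp add: LIM_zero tendsto_norm_zero)
qed

text \<open>The projector provides closedness: for a limit \<open>l\<close> of points of
  \<open>S\<close>, the vector \<open>l - p l\<close> is orthogonal to each
  \<open>u n - p l\<close>, hence in the limit to itself, so \<open>l = p l\<close>.\<close>

lemma closed: "closed S"
  unfolding closed_sequential_limits
proof (intro allI impI, elim conjE)
  fix u l assume u: "\<forall>n. u n \<in> S" and l: "u \<longlonglongrightarrow> l"
  have "inner (l - p l) (u n - p l) = 0" for n
    using proj u subspace_diff[OF sub]
    by (auto simp: orthogonal_projector_def orthogonal_def)
  moreover have "(\<lambda>n. inner (l - p l) (u n - p l)) \<longlonglongrightarrow> inner (l - p l) (l - p l)"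
    by (intro tendsto_intros l)
  ultimately have "inner (l - p l) (l - p l) = 0"
    by (simp add: LIMSEQ_const_iff)
  then have "l = p l" by simp
  then show "l \<in> S"
    using proj by (metis orthogonal_projector_def)
qed

text \<open>The Riesz representation of \<open>\<lambda>x. inner (f x) z\<close> is found as the minimiser of the functional
  \<open>J\<close> below; the parallelogram law makes every minimising sequence Cauchy.\<close>

lemma riesz: "\<exists>w\<in>S. \<forall>x\<in>S. inner (f x) z = inner x w"
proof -
  define J where "J x = inner x x - 2 * inner (f x) z" for x
  define m where "m = (INF x\<in>S. J x)"
  have J_ge: "- (norm z)\<^sup>2 \<le> J x" if "x \<in> S" for x
  proof -
    have "inner (f x) z \<le> norm x * norm z"
      using norm_cauchy_schwarz[of "f x" z] mult_right_mono[OF norm_le[OF that], of "norm z"]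
      by simp
    moreover have "0 \<le> (norm x - norm z)\<^sup>2" by simp
    ultimately show ?thesis
      unfolding J_def power2_norm_eq_inner[symmetric] by (simp add: power2_diff)
  qed
  then have bdd: "bdd_below (J ` S)" by (intro bdd_belowI2)
  have m_le: "m \<le> J x" if "x \<in> S" for x
    unfolding m_def using bdd that by (rule cINF_lower)
  have "\<exists>w\<in>S. J w < m + inverse (real (Suc n))" for n
  proof -
    have "Inf (J ` S) < m + inverse (real (Suc n))"
      by (simp add: m_def)
    then show ?thesis
      using cInf_lessD[of "J ` S"] subspace_0[OF sub] by blast
  qed
  then obtain u where uS: "u n \<in> S" and Ju: "J (u n) < m + inverse (real (Suc n))" for n
    by metis
  \<comment> \<open>The parallelogram law gives an equality with \<open>J\<close> at the midpoint of
    \<open>a\<close> and \<open>b\<close>; that value is at least \<open>m\<close>.\<close>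
  have para: "(norm (a - b))\<^sup>2 \<le> 2 * (J a - m) + 2 * (J b - m)" if "a \<in> S" "b \<in> S" for a b
  proof -
    have "(1/2) *\<^sub>R (a + b) \<in> S"
      using that sub by (simp add: subspace_add subspace_scale)
    moreover have "f ((1/2) *\<^sub>R (a + b)) = (1/2) *\<^sub>R (f a + f b)"
      using that by (simp add: add scale sub subspace_add)
    then have "(norm (a - b))\<^sup>2 = 2 * J a + 2 * J b - 4 * J ((1/2) *\<^sub>R (a + b))"
      by (simp add: J_def power2_norm_eq_inner inner_diff inner_add_left inner_add_right
          inner_commute[of b a] field_simps)
    ultimately show ?thesis using m_le by fastforce
  qed
  have "Cauchy u"
  proof (rule metric_CauchyI)
    fix e :: real assume "0 < e"
    then obtain M where M: "inverse (real (Suc M)) < e\<^sup>2 / 4"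
      using reals_Archimedean[of "e\<^sup>2 / 4"] by auto
    have J_close: "J (u n) - m < e\<^sup>2 / 4" if "M \<le> n" for n
    proof -
      have "inverse (real (Suc n)) \<le> inverse (real (Suc M))"
        using that by (intro le_imp_inverse_le) auto
      then show ?thesis using Ju[of n] M by linarith
    qed
    have "dist (u i) (u j) < e" if "M \<le> i" "M \<le> j" for i j
    proof -
      have "(norm (u i - u j))\<^sup>2 < e\<^sup>2"
        using para[OF uS uS, of i j] J_close[OF that(1)] J_close[OF that(2)] by argo
      then show ?thesis
        using \<open>0 < e\<close> by (simp add: dist_norm power2_less_imp_less)
    qed
    then show "\<exists>M. \<forall>i\<ge>M. \<forall>j\<ge>M. dist (u i) (u j) < e" by blast
  qed
  then obtain w where uw: "u \<longlonglongrightarrow> w"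
    using Cauchy_convergent convergent_def by blast
  then have wS: "w \<in> S"
    using closed uS closed_sequentially by blast
  have "(\<lambda>n. f (u n)) \<longlonglongrightarrow> f w"
    using uS wS uw by (rule tendsto)
  then have "(\<lambda>n. J (u n)) \<longlonglongrightarrow> J w"
    unfolding J_def by (intro tendsto_intros uw)
  moreover have "(\<lambda>n. m + inverse (real (Suc n))) \<longlonglongrightarrow> m"
    using tendsto_add[OF tendsto_const LIMSEQ_inverse_real_of_nat, of m] by simp
  ultimately have Jw: "J w \<le> m"
    by (rule LIMSEQ_le) (use Ju less_imp_le in blast)
  have "inner (f x) z = inner x w" if xS: "x \<in> S" for x
  proof -
    define c where "c = inner x w - inner (f x) z"
    \<comment> \<open>The difference \<open>J (w + t *\<^sub>R x) - J w\<close>, which is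
      nonnegative because \<open>w\<close> is a minimiser; \<open>c\<close> is half its derivative
      at \<open>t = 0\<close>.\<close>
    have quad: "0 \<le> 2 * t * c + t\<^sup>2 * inner x x" for t
    proof -
      have "w + t *\<^sub>R x \<in> S" using sub wS xS by (simp add: subspace_add subspace_scale)
      then have "J w \<le> J (w + t *\<^sub>R x)" using m_le Jw by fastforce
      moreover have "f (w + t *\<^sub>R x) = f w + t *\<^sub>R f x"
        using sub wS xS by (simp add: add scale subspace_scale)
      ultimately show ?thesis
        by (simp add: J_def c_def inner_add_left inner_add_right inner_commute[of w x]
            algebra_simps power2_eq_square)
    qed
    have "c = 0"
    proof (cases "inner x x = 0")
      case True
      then show ?thesis by (simp add: c_def zero)
    next
      case False
      then have pos: "0 < inner x x" by simp
      \<comment> \<open>The chosen \<open>t\<close> is the vertex of the parabola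
        \<open>quad\<close>, where its value is negative unless \<open>c = 0\<close>.\<close>
      have "2 * (- c / inner x x) * c + (- c / inner x x)\<^sup>2 * inner x x = - (c\<^sup>2 / inner x x)"
        using False by (simp add: power2_eq_square field_simps)
      then have "c\<^sup>2 / inner x x \<le> 0" using quad[of "- c / inner x x"] by linarith
      then show ?thesis using pos by (simp add: divide_le_0_iff)
    qed
    then show ?thesis by (simp add: c_def)
  qed
  then show ?thesis using wS by blast
qed

text \<open>Makes the definite description in \<open>adjoint_on\<close> usable. Existence is
  \<open>riesz\<close>; the difference of two representers lies in \<open>S\<close> and is
  orthogonal to itself.\<close>

lemma adjoint_on_spec:
  "adjoint_on S f z \<in> S \<and> (\<forall>x\<in>S. inner (f x) z = inner x (adjoint_on S f z))"
  unfolding adjoint_on_def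
proof (rule theI')
  obtain w where w: "w \<in> S" "\<forall>x\<in>S. inner (f x) z = inner x w" using riesz by blast
  moreover have "v = w" if "v \<in> S" "\<forall>x\<in>S. inner (f x) z = inner x v" for v
  proof -
    have "v - w \<in> S" using w that sub by (simp add: subspace_diff)
    then have "inner (v - w) (v - w) = 0" using w that by (simp add: inner_diff_right)
    then show ?thesis by simp
  qed
  ultimately show "\<exists>!w. w \<in> S \<and> (\<forall>x\<in>S. inner (f x) z = inner x w)" by blast
qed

lemma adjoint_on_in: "adjoint_on S f z \<in> S"
  and inner_adjoint_on: "x \<in> S \<Longrightarrow> inner x (adjoint_on S f z) = inner (f x) z"
  using adjoint_on_spec by auto

text \<open>Test the adjoint relation with the adjoint vector itself and cancel one factor of its
  norm.\<close>

lemma norm_adjoint_on_le: "norm (adjoint_on S f z) \<le> norm z"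
proof (cases "adjoint_on S f z = 0")
  case False
  let ?w = "adjoint_on S f z"
  have "norm ?w * norm ?w = inner (f ?w) z"
    using inner_adjoint_on[OF adjoint_on_in, of z z]
    by (simp add: power2_norm_eq_inner[symmetric] power2_eq_square)
  also have "\<dots> \<le> norm (f ?w) * norm z" by (rule norm_cauchy_schwarz)
  also have "\<dots> \<le> norm ?w * norm z"
    by (intro mult_right_mono norm_le adjoint_on_in) simp
  finally show ?thesis using False by simp
qed simp


section \<open>The Landweber--Richardson iteration on one level\<close>

context
  fixes y :: 'b and u :: "nat \<Rightarrow> 'a"
  assumes u_0: "u 0 \<in> S"
    and u_Suc: "\<And>k. u (Suc k) = u k - adjoint_on S f (f (u k) - y)"
begin

lemma iterate_in: "u k \<in> S"
  by (induction k) (auto simp: u_0 u_Suc sub subspace_diff adjoint_on_in)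

text \<open>Expand the square of \<open>e - a\<close>. The cross term contributes minus twice the
  squared residual, of which \<open>norm_adjoint_on_le\<close> uses up one copy. The point
  \<open>c\<close> may be a mere near-solution; its residual is the price, which allows
  \<open>c = P N xs\<close> on coarse levels.\<close>

lemma error_decrease:
  assumes "c \<in> S"
  shows "(norm (u (Suc k) - c))\<^sup>2 \<le>
    (norm (u k - c))\<^sup>2 - norm (f (u k) - y) * (norm (f (u k) - y) - 2 * norm (f c - y))"
proof -
  define e r a where "e = u k - c" and "r = f (u k) - y" and "a = adjoint_on S f r"
  have fe: "f e = r - (f c - y)" using assms by (simp add: e_def r_def diff iterate_in)
  have "e \<in> S" using assms by (simp add: e_def sub subspace_diff iterate_in)
  then have ea: "inner e a = inner r r - inner (f c - y) r"
    by (simp add: a_def inner_adjoint_on fe inner_diff_left)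
  have "(norm (e - a))\<^sup>2 = (norm e)\<^sup>2 - 2 * inner e a + (norm a)\<^sup>2"
    by (simp add: power2_norm_eq_inner inner_diff inner_commute)
  moreover have "(norm a)\<^sup>2 \<le> (norm r)\<^sup>2"
    by (simp add: a_def norm_adjoint_on_le power_mono)
  moreover have "inner (f c - y) r \<le> norm (f c - y) * norm r" by (rule norm_cauchy_schwarz)
  moreover have "inner r r = (norm r)\<^sup>2" by (simp add: power2_norm_eq_inner)
  ultimately have "(norm (e - a))\<^sup>2 \<le> (norm e)\<^sup>2 - norm r * (norm r - 2 * norm (f c - y))"
    using ea by (simp add: right_diff_distrib power2_eq_square mult.commute)
  moreover have "u (Suc k) - c = e - a" by (simp add: u_Suc e_def a_def r_def)
  ultimately show ?thesis by (simp only: e_def r_def)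
qed

lemma residual_le_eventually:
  assumes "c \<in> S" "0 < D" "2 * norm (f c - y) < D"
  shows "\<exists>k. norm (f (u (Suc k)) - y) \<le> D"
proof (rule ccontr)
  assume "\<not> ?thesis"
  then have large: "D < norm (f (u (Suc k)) - y)" for k by (simp add: not_le)
  define q where "q = D * (D - 2 * norm (f c - y))"
  have "0 < q" using assms by (simp add: q_def)
  have step: "(norm (u (Suc (Suc k)) - c))\<^sup>2 \<le> (norm (u (Suc k) - c))\<^sup>2 - q" for k
  proof -
    have "q \<le> norm (f (u (Suc k)) - y) * (norm (f (u (Suc k)) - y) - 2 * norm (f c - y))"
      unfolding q_def using large[of k] assms by (intro mult_mono) auto
    then show ?thesis using error_decrease[OF assms(1), of "Suc k"] by linarith
  qed
  \<comment> \<open>Counting starts at \<open>u 1\<close>, since nothing is assumed about the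
    residual of \<open>u 0\<close>.\<close>
  have "(norm (u (Suc k) - c))\<^sup>2 \<le> (norm (u 1 - c))\<^sup>2 - real k * q" for k
  proof (induction k)
    case (Suc k)
    then show ?case using step[of k] by (simp add: algebra_simps)
  qed simp
  then have "real k * q \<le> (norm (u 1 - c))\<^sup>2" for k
    by (smt (verit) zero_le_power2)
  moreover obtain k where "(norm (u 1 - c))\<^sup>2 < real k * q"
    using reals_Archimedean3[OF \<open>0 < q\<close>] by blast
  ultimately show False by (metis not_le)
qed

text \<open>The new residual is \<open>r - f a\<close>, where \<open>inner r (f a)\<close> is the
  squared norm of \<open>a\<close> and \<open>f a\<close> is no longer than \<open>a\<close>. So its
  square drops by at least that squared norm.\<close>

lemma residual_Suc_le: "norm (f (u (Suc k)) - y) \<le> norm (f (u k) - y)"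
proof -
  define r a where "r = f (u k) - y" and "a = adjoint_on S f r"
  have a: "a \<in> S" by (simp add: a_def adjoint_on_in)
  have "inner r (f a) = (norm a)\<^sup>2"
    using inner_adjoint_on[OF a, of r]
    by (simp add: a_def[symmetric] inner_commute power2_norm_eq_inner)
  moreover have "(norm (f a))\<^sup>2 \<le> (norm a)\<^sup>2" by (simp add: a norm_le power_mono)
  moreover have "(norm (r - f a))\<^sup>2 = (norm r)\<^sup>2 - 2 * inner r (f a) + (norm (f a))\<^sup>2"
    by (simp add: power2_norm_eq_inner inner_diff inner_commute)
  ultimately have "(norm (r - f a))\<^sup>2 \<le> (norm r)\<^sup>2"
    using zero_le_power2[of "norm a"] by linarith
  then have "norm (r - f a) \<le> norm r" by (rule power2_le_imp_le) simp
  moreover have "f (u (Suc k)) - y = r - f a"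
    using diff[OF iterate_in a, of k] by (simp add: u_Suc r_def a_def)
  ultimately show ?thesis by (simp only: r_def)
qed

lemma residual_antimono: "j \<le> k \<Longrightarrow> norm (f (u k) - y) \<le> norm (f (u j) - y)"
  by (rule lift_Suc_antimono_le) (rule residual_Suc_le)

lemma iterates_converge:
  assumes c: "c \<in> S" "f c = y"
  shows "\<exists>x\<in>S. f x = y \<and> u \<longlonglongrightarrow> x"
proof -
  define E R where "E k = (norm (u k - c))\<^sup>2" and "R k = (norm (f (u k) - y))\<^sup>2" for k
  have ER: "E (Suc k) + R k \<le> E k" for k
    using error_decrease[OF c(1), of k] by (simp add: E_def R_def c(2) power2_eq_square)
  have sum_R: "(\<Sum>i=j..<k. R i) \<le> E j - E k" if "j \<le> k" for j k
    using that
  proof (induction k rule: dec_induct)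
    case (step k)
    then show ?case using ER[of k] by simp
  qed simp
  have "decseq E" by (rule decseq_SucI) (smt (verit) ER R_def zero_le_power2)
  moreover have "0 \<le> E k" for k by (simp add: E_def)
  ultimately obtain L where "E \<longlonglongrightarrow> L" using decseq_convergent by blast
  then have "Cauchy E" by (rule LIMSEQ_imp_Cauchy)
  \<comment> \<open>Telescoping \<open>u j - u k\<close> and moving each adjoint across leaves inner
    products of residuals. The error is taken at the later index \<open>k\<close>, whose residual is
    the smallest, so each term is at most \<open>R i\<close>.\<close>
  have inner_le: "\<bar>inner (u k - c) (u j - u k)\<bar> \<le> (\<Sum>i=j..<k. R i)" if "j \<le> k" for j k
  proof -
    have tel: "u j - u l = (\<Sum>i=j..<l. adjoint_on S f (f (u i) - y))" if "j \<le> l" for l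
      using that by (induction l rule: dec_induct) (auto simp: u_Suc algebra_simps)
    have "u k - c \<in> S" using c by (simp add: sub subspace_diff iterate_in)
    then have "inner (u k - c) (u j - u k) = (\<Sum>i=j..<k. inner (f (u k) - y) (f (u i) - y))"
      by (simp add: tel[OF that] inner_sum_right inner_adjoint_on diff iterate_in c)
    also have "\<bar>\<dots>\<bar> \<le> (\<Sum>i=j..<k. \<bar>inner (f (u k) - y) (f (u i) - y)\<bar>)" by (rule sum_abs)
    also have "\<dots> \<le> (\<Sum>i=j..<k. R i)"
    proof (rule sum_mono)
      fix i assume "i \<in> {j..<k}"
      then have "norm (f (u k) - y) * norm (f (u i) - y) \<le> R i"
        by (simp add: R_def power2_eq_square mult_right_mono residual_antimono)
      then show "\<bar>inner (f (u k) - y) (f (u i) - y)\<bar> \<le> R i"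
        using Cauchy_Schwarz_ineq2 order_trans by blast
    qed
    finally show ?thesis .
  qed
  \<comment> \<open>One share of \<open>E j - E k\<close> comes from expanding \<open>E j\<close>
    around \<open>u k\<close>, two more from the cross term.\<close>
  have dist_le: "(norm (u j - u k))\<^sup>2 \<le> 3 * (E j - E k)" if "j \<le> k" for j k
  proof -
    have "E j = (norm ((u k - c) + (u j - u k)))\<^sup>2" by (simp add: E_def)
    also have "\<dots> = E k + 2 * inner (u k - c) (u j - u k) + (norm (u j - u k))\<^sup>2"
      unfolding E_def power2_norm_eq_inner inner_add_left inner_add_right
      by (simp add: inner_commute)
    finally show ?thesis using inner_le[OF that] sum_R[OF that] by argo
  qed
  have "Cauchy u"
  proof (rule metric_CauchyI)
    fix e :: real assume "0 < e"
    then obtain M where M: "\<And>j k. M \<le> j \<Longrightarrow> M \<le> k \<Longrightarrow> \<bar>E j - E k\<bar> < e\<^sup>2 / 3"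
      using metric_CauchyD[OF \<open>Cauchy E\<close>, of "e\<^sup>2 / 3"] by (auto simp: dist_real_def)
    have le: "dist (u j) (u k) < e" if "M \<le> j" "j \<le> k" for j k
    proof -
      have "(norm (u j - u k))\<^sup>2 < e\<^sup>2"
        using dist_le[OF that(2)] M[OF that(1) order_trans[OF that]] by argo
      then show ?thesis using \<open>0 < e\<close> by (simp add: dist_norm power2_less_imp_less)
    qed
    then have "dist (u j) (u k) < e" if "M \<le> j" "M \<le> k" for j k
      using that by (metis dist_commute nat_le_linear)
    then show "\<exists>M. \<forall>j\<ge>M. \<forall>k\<ge>M. dist (u j) (u k) < e" by blast
  qed
  then obtain x where ux: "u \<longlonglongrightarrow> x" using Cauchy_convergent convergent_def by blast
  then have xS: "x \<in> S" using closed iterate_in closed_sequentially by blast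
  \<comment> \<open>By \<open>ER\<close> these differences dominate \<open>R\<close>, so the
    residuals tend to 0 and the limit solves the equation.\<close>
  have "(\<lambda>k. E k - E (Suc k)) \<longlonglongrightarrow> L - L"
    using \<open>E \<longlonglongrightarrow> L\<close> LIMSEQ_Suc by (intro tendsto_diff)
  then have "R \<longlonglongrightarrow> 0"
  proof (intro tendsto_sandwich[of "\<lambda>_. 0" R sequentially "\<lambda>k. E k - E (Suc k)"])
    show "\<forall>\<^sub>F k in sequentially. R k \<le> E k - E (Suc k)"
      using ER by (intro always_eventually allI) (simp add: algebra_simps)
  qed (auto simp: R_def)
  then have "(\<lambda>k. sqrt (R k)) \<longlonglongrightarrow> 0" using tendsto_real_sqrt by fastforce
  then have "(\<lambda>k. f (u k) - y) \<longlonglongrightarrow> 0" by (simp add: R_def tendsto_norm_zero_iff)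
  then have fy: "(\<lambda>k. f (u k)) \<longlonglongrightarrow> y" by (rule LIM_zero_cancel)
  have "(\<lambda>k. f (u k)) \<longlonglongrightarrow> f x"
    using iterate_in xS ux by (rule tendsto)
  then have "f x = y" using fy LIMSEQ_unique by blast
  then show ?thesis using xS ux by blast
qed

end

end

lemma orthogonal_projector_fixes:
  assumes "orthogonal_projector S p" "subspace S" "x \<in> S"
  shows "p x = x"
proof -
  have "x - p x \<in> S" using assms by (simp add: orthogonal_projector_def subspace_diff)
  then have "orthogonal (x - p x) (x - p x)" using assms(1) by (auto simp: orthogonal_projector_def)
  then show ?thesis by (simp add: orthogonal_def)
qed


section \<open>Runs of the multi-level algorithm\<close>

lemma mlr_run_Suc:
  "mlr_run X T P xs \<eta> \<tau> \<delta> yd s (Suc n) =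
    mlr_step X T P xs \<eta> \<tau> \<delta> yd (mlr_run X T P xs \<eta> \<tau> \<delta> yd s n)"
  by (simp add: mlr_run_def)

lemma mlr_run_add:
  "mlr_run X T P xs \<eta> \<tau> \<delta> yd s (m + n) =
    mlr_run X T P xs \<eta> \<tau> \<delta> yd (mlr_run X T P xs \<eta> \<tau> \<delta> yd s m) n"
  by (simp add: mlr_run_def funpow_add[unfolded o_def] add.commute[of m])

lemma mlr_run_Terminated: "mlr_run X T P xs \<eta> \<tau> \<delta> yd (Terminated x) n = Terminated x"
  by (induction n) (simp_all add: mlr_run_def)

lemma mlr_converges_Terminated: "mlr_converges X T P xs \<eta> \<tau> \<delta> yd (Terminated x) x"
  unfolding mlr_converges_def by (simp add: mlr_run_Terminated)

text \<open>Convergence depends only on the tail of a run, and termination is absorbing, so a finite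
  prefix may be dropped. This lets results for a later level be pulled back to an earlier
  one.\<close>

lemma mlr_converges_run:
  assumes "mlr_converges X T P xs \<eta> \<tau> \<delta> yd (mlr_run X T P xs \<eta> \<tau> \<delta> yd s m) x"
  shows "mlr_converges X T P xs \<eta> \<tau> \<delta> yd s x"
proof -
  let ?run = "mlr_run X T P xs \<eta> \<tau> \<delta> yd"
  have add: "?run (?run s m) n = ?run s (n + m)" for n
    by (simp add: mlr_run_add[symmetric] add.commute)
  have "\<exists>n. ?run s n = Terminated x" if "?run (?run s m) n = Terminated x" for n
    using that add by metis
  moreover have "\<nexists>n z. ?run s n = Terminated z" if "\<nexists>n z. ?run (?run s m) n = Terminated z"
    using that by (metis add mlr_run_Terminated mlr_run_add)
  moreover have "(\<lambda>n. mlr_iterate X T yd (?run s n)) \<longlonglongrightarrow> x"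
    if "(\<lambda>n. mlr_iterate X T yd (?run (?run s m) n)) \<longlonglongrightarrow> x"
    using that unfolding add by (rule LIMSEQ_offset)
  ultimately show ?thesis using assms unfolding mlr_converges_def by blast
qed

text \<open>Index 0 is excluded because the step away from the starting point of a level is taken
  without a test.\<close>

lemma mlr_run_Iterating:
  assumes "\<And>j. 0 < j \<Longrightarrow> j < k \<Longrightarrow>
    \<not> norm (T N (landweber X T yd N z j) - yd) \<le> level_tol P xs \<eta> \<delta> N"
  shows "mlr_run X T P xs \<eta> \<tau> \<delta> yd (Iterating N z 0) k = Iterating N z k"
  using assms
proof (induction k)
  case 0
  then show ?case by (simp add: mlr_run_def)
next
  case (Suc k)
  then have "mlr_run X T P xs \<eta> \<tau> \<delta> yd (Iterating N z 0) k = Iterating N z k" by simp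
  then show ?case using Suc.prems[of k] by (cases k) (simp_all add: mlr_run_Suc)
qed

theorem theorem3p5:
  fixes X :: "nat \<Rightarrow> 'a::{real_inner, polish_space} set"
    and P :: "nat \<Rightarrow> 'a \<Rightarrow> 'a"
    and T :: "nat \<Rightarrow> 'a \<Rightarrow> 'b::{real_inner, polish_space}"
    and y :: 'b
    and xs x0 :: 'a
    and Ns :: nat
    and \<eta> \<tau> :: real
  assumes "\<And>N. subspace (X N)"
    and "\<And>N. X N \<subseteq> X (Suc N)"
    and "\<And>N. orthogonal_projector (X N) (P N)"
    and "\<And>N. linear_on (X N) (T N)"
    and "\<And>N. onorm_on (X N) (T N) \<le> 1"
    and "\<And>M N x. M \<le> N \<Longrightarrow> x \<in> X M \<Longrightarrow> T N x = T M x"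
    and "\<And>N. range (adjoint_on (X N) (T N)) \<subseteq> X N"
    and "xs \<in> X Ns" and "T Ns xs = y"
    and "\<eta> > 0" and "\<tau> > 1"
    and "x0 \<in> X 0"
  shows "(\<exists>s. mlr_initial T P xs \<eta> \<tau> 0 y x0 s) \<and>
         (\<forall>s. mlr_initial T P xs \<eta> \<tau> 0 y x0 s \<longrightarrow>
            (\<exists>x. is_solution X T y x \<and> mlr_converges X T P xs \<eta> \<tau> 0 y s x))"
proof -
  note sub = assms(1) and proj = assms(3) and ext = assms(6) and xs = assms(8,9)
  have nested: "x \<in> X N" if "M \<le> N" "x \<in> X M" for M N x
    using lift_Suc_mono_le[of X, OF assms(2) that(1)] that(2) by blast
  have op: "nonexpansive_on (X N) (T N) (P N)" for N
    using assms(1,3,4,5) by unfold_locales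
  have P_in: "P N x \<in> X N" for N x
    using proj by (simp add: orthogonal_projector_def)
  have tol_eq: "level_tol P xs \<eta> 0 N = 2 * (1 + \<eta>) * norm (P N xs - xs)" for N
    by (simp add: level_tol_def)
  have P_xs: "P N xs = xs" if "Ns \<le> N" for N
    using orthogonal_projector_fixes[OF proj sub] nested[OF that] xs by blast
  have residual_P: "norm (T N (P N xs) - y) \<le> norm (P N xs - xs)" for N
  proof -
    \<comment> \<open>Neither of \<open>P N xs\<close> and \<open>xs\<close> need lie on the level
      of the other; on the common level \<open>M\<close> their images can be subtracted.\<close>
    define M where "M = max N Ns"
    interpret nonexpansive_on "X M" "T M" "P M" by (rule op)
    have in_M: "P N xs \<in> X M" "xs \<in> X M"
      using nested[of N M] nested[of Ns M] P_in xs by (auto simp: M_def)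
    have "T N (P N xs) - y = T M (P N xs - xs)"
      using diff[OF in_M] ext[of N M] ext[of Ns M] P_in xs by (simp add: M_def)
    then show ?thesis using norm_le in_M sub by (simp add: subspace_diff)
  qed
  \<comment> \<open>Induction on the number of levels below \<open>Ns\<close>, for arbitrary
    starting points. The truncated difference is 0 from \<open>Ns\<close> on, where no further level
    is entered.\<close>
  have level: "\<exists>x. is_solution X T y x \<and> mlr_converges X T P xs \<eta> \<tau> 0 y (Iterating N z 0) x"
    if "z \<in> X N" for N z
    using that
  proof (induction "Ns - N" arbitrary: N z rule: less_induct)
    case less
    interpret nonexpansive_on "X N" "T N" "P N" by (rule op)
    let ?u = "landweber X T y N z"
    let ?small = "\<lambda>k. norm (T N (?u (Suc k)) - y) \<le> level_tol P xs \<eta> 0 N"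
    have u: "?u 0 \<in> X N" "\<And>k. ?u (Suc k) = ?u k - adjoint_on (X N) (T N) (T N (?u k) - y)"
      using less.prems by simp_all
    note u_in = iterate_in[OF u]
    show ?case
    proof (cases "\<exists>k. ?small k")
      case True
      \<comment> \<open>This is l_*(N, 0): the test at \<open>k\<close> concerns the iterate
        \<open>Suc k\<close>, while the next level starts from the iterate \<open>k\<close>.\<close>
      define k where "k = (LEAST k. ?small k)"
      have small: "?small k" using LeastI_ex[OF True] by (simp add: k_def)
      have "\<not> norm (T N (?u j) - y) \<le> level_tol P xs \<eta> 0 N" if "0 < j" "j < Suc k" for j
        using not_less_Least[of "j - 1" ?small] that by (cases j) (simp_all add: k_def)
      then have "mlr_run X T P xs \<eta> \<tau> 0 y (Iterating N z 0) (Suc k) = Iterating N z (Suc k)"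
        by (rule mlr_run_Iterating)
      then have run: "mlr_run X T P xs \<eta> \<tau> 0 y (Iterating N z 0) (Suc (Suc k)) =
        (if norm (T (Suc N) (?u (Suc k)) - y) \<le> final_tol \<eta> \<tau> 0
         then Terminated (?u (Suc k)) else Iterating (Suc N) (?u k) 0)"
        using small by (subst mlr_run_Suc) (simp del: landweber.simps)
      show ?thesis
      \<comment> \<open>For exact data \<open>final_tol\<close> is 0, so the termination test asks
        for an exact solution on the next level.\<close>
      proof (cases "T (Suc N) (?u (Suc k)) = y")
        case True
        have "is_solution X T y (?u (Suc k))"
          unfolding is_solution_def using True u_in assms(2) by blast
        moreover have "mlr_run X T P xs \<eta> \<tau> 0 y (Iterating N z 0) (Suc (Suc k)) =
          Terminated (?u (Suc k))"
          unfolding run using True by (simp add: final_tol_def del: landweber.simps)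
        then have "mlr_converges X T P xs \<eta> \<tau> 0 y (Iterating N z 0) (?u (Suc k))"
          using mlr_converges_run mlr_converges_Terminated by metis
        ultimately show ?thesis by blast
      next
        case False
        \<comment> \<open>From \<open>Ns\<close> on the tolerance is 0, so passing the level test
          would already give a solution, also on level \<open>Suc N\<close>, and force
          termination.\<close>
        have "N < Ns"
        proof (rule ccontr)
          assume "\<not> N < Ns"
          then have "T N (?u (Suc k)) = y"
            using small by (simp add: tol_eq P_xs del: landweber.simps)
          then show False using False ext[of N "Suc N"] u_in[of "Suc k"]
            by (simp del: landweber.simps)
        qed
        moreover have "?u k \<in> X (Suc N)" using u_in assms(2) by blast
        ultimately obtain x where "is_solution X T y x"
          "mlr_converges X T P xs \<eta> \<tau> 0 y (Iterating (Suc N) (?u k) 0) x"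
          using less.hyps[OF diff_less_mono2[OF lessI]] by blast
        moreover have "mlr_run X T P xs \<eta> \<tau> 0 y (Iterating N z 0) (Suc (Suc k)) =
          Iterating (Suc N) (?u k) 0"
          unfolding run using False by (simp add: final_tol_def del: landweber.simps)
        ultimately show ?thesis using mlr_converges_run by metis
      qed
    next
      case False
      \<comment> \<open>Otherwise \<eta> > 0 makes the tolerance exceed twice the residual of
        \<open>P N xs\<close>, and \<open>residual_le_eventually\<close> would end the
        level.\<close>
      have "P N xs = xs"
      proof (rule ccontr)
        assume "P N xs \<noteq> xs"
        then have pos: "0 < norm (P N xs - xs)" by simp
        then have "2 * norm (P N xs - xs) < level_tol P xs \<eta> 0 N"
          using \<open>\<eta> > 0\<close> by (simp add: tol_eq)
        then show False
          using residual_le_eventually[OF u P_in, of "level_tol P xs \<eta> 0 N"]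
            False pos residual_P[of N]
          by (smt (verit))
      qed
      then have "xs \<in> X N" "T N xs = y" using P_in[of N xs] residual_P[of N] by simp_all
      then obtain x where x: "x \<in> X N" "T N x = y" "?u \<longlonglongrightarrow> x"
        using iterates_converge[OF u] by blast
      have "\<not> norm (T N (?u j) - y) \<le> level_tol P xs \<eta> 0 N" if "0 < j" for j
        using False that by (cases j) auto
      then have run: "mlr_run X T P xs \<eta> \<tau> 0 y (Iterating N z 0) k = Iterating N z k" for k
        by (intro mlr_run_Iterating)
      \<comment> \<open>By \<open>run\<close> the algorithm never leaves level \<open>N\<close>, so
        its iterates are exactly the sequence \<open>?u\<close>.\<close>
      have "mlr_converges X T P xs \<eta> \<tau> 0 y (Iterating N z 0) x"
        unfolding mlr_converges_def using x(3) by (simp add: run)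
      then show ?thesis using x unfolding is_solution_def by blast
    qed
  qed
  show ?thesis
  proof (intro conjI allI impI)
    \<comment> \<open>An admissible starting level always exists: \<open>Ns\<close> qualifies, since
      both tolerances are 0 there and the residual of \<open>x0\<close> is the same as on level
      0.\<close>
    have "norm (T Ns x0 - y) > level_tol P xs \<eta> 0 Ns" if "norm (T 0 x0 - y) > final_tol \<eta> \<tau> 0"
      using that ext[of 0 Ns x0] assms(12) by (simp add: tol_eq P_xs final_tol_def)
    then show "\<exists>s. mlr_initial T P xs \<eta> \<tau> 0 y x0 s"
      by (metis mlr_initial.intros)
  next
    fix s assume "mlr_initial T P xs \<eta> \<tau> 0 y x0 s"
    then show "\<exists>x. is_solution X T y x \<and> mlr_converges X T P xs \<eta> \<tau> 0 y s x"
    proof cases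
      case accept
      then have "is_solution X T y x0"
        using assms(12) unfolding is_solution_def by (auto simp: final_tol_def)
      then show ?thesis using accept mlr_converges_Terminated by blast
    next
      case level0
      then show ?thesis using level assms(12) by blast
    next
      case (levelJ J)
      then show ?thesis using level nested[of 0 J] assms(12) by blast
    qed
  qed
qed

end
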